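(* Let $\mathcal{C}$ be a shellable simplicial complex. Then any shelling $(F_1,\ldots,F_s)$ of $\mathcal{C}$ is stable.
   Context: A polytopal complex is a collection of (abstract) polytopes that contains the empty polytope $\emptyset$ (of dimension $-1$), is closed under taking faces, and in which any two members intersect in a common face of both. Its maximal members are its facets; it is pure if all facets have the same dimension; it is a simplicial complex if all facets are simplices. For a polytope $P$, $\mathcal{C}(P)$ is the complex of all faces of $P$ and $\mathcal{C}(\partial P)$ the complex of all proper faces; for a finite collection of polytopes, $\mathcal{C}(\{P_1,\dots,P_m\})=\mathcal{C}(P_1\cup\cdots\cup P_m)=\bigcup_i\mathcal{C}(P_i)$ (having no faces at all if the collection is empty). If $\mathcal{D}$ is a subcomplex of $\mathcal{C}$, $\mathcal{C}\setminus\mathcal{D}=\{P\in\mathcal{C}:P\notin\mathcal{D}\}$ is called a relative complex. A shelling of a pure $d$-dimensional polytopal complex $\mathcal{C}$ is a linear ordering $(F_1,\ldots,F_s)$ of its facets such that either $d=0$, or (1) $\mathcal{C}(\partial F_1)$ has a shelling, and (2) for $2\le j\le s$, $F_j\cap\bigcup_{i<j}F_i$ is nonempty and equals $G_1\cup\cdots\cup G_r$ for some shelling $(G_1,\ldots,G_r,\ldots,G_t)$ of $\mathcal{C}(\partial F_j)$ and some $r\in[t]$. A complex is shellable if it is pure and admits a shelling. For a polytope $P$, let $L(P)$ be its face lattice (all faces including $\emptyset$ and $P$, ordered by inclusion), $[F,P]$ the closed interval of faces containing $F$, ${}^\ast$ the dual poset, and $A(\cdot)$ the set of atoms of a poset with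 a least element. Thus $A([F,P]^\ast)$ is the set of facets of $P$ containing $F$ (empty if $F=P$, all facets if $F=\emptyset$), and $A(L(P)^\ast)$ is the set of all facets of $P$. The reciprocal domains associated to a face $F$ of $P$ are the relative complexes $$\mathcal{C}(P)\setminus\mathcal{C}(A([F,P]^\ast))\quad\text{and}\quad \mathcal{C}(P)\setminus\mathcal{C}(A(L(P)^\ast)\setminus A([F,P]^\ast)).$$ A relative complex is stable if it is isomorphic to one of the reciprocal domains associated to some face $F$ (possibly $\emptyset$ or $P$) of some polytope $P$; here $\mathcal{C}\setminus\mathcal{D}$ and $\mathcal{C}'\setminus\mathcal{D}'$ are isomorphic if there is an inclusion-preserving (both ways) bijection $\mathcal{C}\to\mathcal{C}'$ mapping $\mathcal{D}$ onto $\mathcal{D}'$. A shelling $(F_1,\ldots,F_s)$ of $\mathcal{C}$ is stable if for all $i\in[s]$ the relative complex $\mathcal{R}_i=\mathcal{C}(F_i)\setminus\mathcal{C}(F_1\cup\cdots\cup F_{i-1})$, viewed as $\mathcal{C}(F_i)$ minus its subcomplex $\mathcal{C}(F_i)\cap\bigcup_{k<i}\mathcal{C}(F_k)$, is stable. *)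

theory Defs
  imports "HOL-Analysis.Analysis" "HOL-Analysis.Finite_Function_Topology"
begin

section \<open>Abstract polytopes\<close>

text \<open>
  An abstract polytope is a convex polytope up to combinatorial equivalence, with labelled
  vertices: it is given by the family of the vertex sets of all its faces, including the empty
  face and the polytope itself. The labels come from an arbitrary type.

  The space of finitely supported real sequences is the union of all \<open>\<real>\<^sup>n\<close>, so quantifying over
  the polytopes in it is quantifying over the polytopes of all dimensions. It is a real vector
  space, but not in the class \<open>euclidean_space\<close>, to which \<open>aff_dim\<close> and \<open>simplex\<close> are restricted;
  these two are therefore spelled out below, with the finiteness that is automatic in finite
  dimension.
\<close>

type_synonym point = "nat \<Rightarrow>\<^sub>0 real"

definition verts :: "point set \<Rightarrow> point set"
  where "verts Q = {x. x extreme_point_of Q}"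

definition realizes :: "point set \<Rightarrow> 'v set set \<Rightarrow> bool"
  where "realizes Q P \<longleftrightarrow>
    polytope Q \<and>
    (\<exists>\<phi>. inj_on \<phi> (verts Q) \<and> P = (\<lambda>F. \<phi> ` verts F) ` {F. F face_of Q})"

definition abs_polytope :: "'v set set \<Rightarrow> bool"
  where "abs_polytope P \<longleftrightarrow> (\<exists>Q. realizes Q P)"

definition has_affine_dim :: "point set \<Rightarrow> int \<Rightarrow> bool"
  where "has_affine_dim Q d \<longleftrightarrow>
    (\<exists>B. finite B \<and> \<not> affine_dependent B \<and> affine hull B = affine hull Q \<and> int (card B) = d + 1)"

text \<open>
  Combinatorially equivalent polytopes have the same dimension, so the choice is immaterial.
  The empty polytope \<open>{{}}\<close> has dimension \<open>-1\<close>.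
\<close>

definition poly_dim :: "'v set set \<Rightarrow> int"
  where "poly_dim P = (SOME d. \<exists>Q. realizes Q P \<and> has_affine_dim Q d)"

definition abs_simplex :: "'v set set \<Rightarrow> bool"
  where "abs_simplex P \<longleftrightarrow>
    (\<exists>Q B. realizes Q P \<and> finite B \<and> \<not> affine_dependent B \<and> Q = convex hull B)"

text \<open>
  The face of \<open>P\<close> with vertex set \<open>G\<close> is itself an abstract polytope, namely the family of all
  members of \<open>P\<close> contained in \<open>G\<close>. Inclusion of these families is inclusion of faces, so
  \<open>faces P\<close>, ordered by \<open>\<subseteq>\<close>, is the face lattice \<open>L(P)\<close>; it is also the complex \<open>\<C>(P)\<close>.
\<close>

definition faces :: "'v set set \<Rightarrow> 'v set set set"
  where "faces P = {{H \<in> P. H \<subseteq> G} | G. G \<in> P}"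

definition boundary_complex :: "'v set set \<Rightarrow> 'v set set set"
  where "boundary_complex P = faces P - {P}"

text \<open>The complex generated by the empty collection has no faces at all, not even \<open>{{}}\<close>.\<close>

definition complex_of :: "'v set set set \<Rightarrow> 'v set set set"
  where "complex_of \<P> = (\<Union>P\<in>\<P>. faces P)"


section \<open>Polytopal complexes\<close>

text \<open>The intersection of two polytopes is the family of their common faces.\<close>

definition polytopal_complex :: "'v set set set \<Rightarrow> bool"
  where "polytopal_complex C \<longleftrightarrow>
    (\<forall>P\<in>C. abs_polytope P) \<and>
    {{}} \<in> C \<and>
    (\<forall>P\<in>C. faces P \<subseteq> C) \<and>
    (\<forall>P\<in>C. \<forall>Q\<in>C. P \<inter> Q \<in> faces P \<and> P \<inter> Q \<in> faces Q)"

definition facets :: "'v set set set \<Rightarrow> 'v set set set"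
  where "facets C = {F \<in> C. \<forall>P\<in>C. F \<subseteq> P \<longrightarrow> P = F}"

definition simplicial_polytopal_complex :: "'v set set set \<Rightarrow> bool"
  where "simplicial_polytopal_complex C \<longleftrightarrow>
    polytopal_complex C \<and> (\<forall>F\<in>facets C. abs_simplex F)"

text \<open>
  The bound on the dimension of all members follows from the condition on the facets if \<open>C\<close> is
  finite. In general it excludes infinite complexes with members that lie in no facet.
\<close>

definition pure_complex :: "int \<Rightarrow> 'v set set set \<Rightarrow> bool"
  where "pure_complex d C \<longleftrightarrow>
    polytopal_complex C \<and>
    (\<forall>P\<in>C. poly_dim P \<le> d) \<and>
    (\<forall>F\<in>facets C. poly_dim F = d)"


section \<open>Shellings\<close>

text \<open>
  Lists are indexed from \<open>0\<close>, so \<open>take j Fs\<close> consists of the facets before \<open>Fs ! j\<close>. An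
  intersection of faces always contains the empty face; it is nonempty as a union of polytopes iff
  it contains another one, that is, iff it differs from \<open>{{}}\<close>. The recursion descends in the
  dimension and stops at \<open>d = 0\<close>. The complex \<open>{{{}}}\<close>, of dimension \<open>-1\<close>, has no shelling, since
  \<open>boundary_complex {{}} = {}\<close> lacks the empty polytope and so is not a polytopal complex.
\<close>

inductive shelling :: "'v set set set \<Rightarrow> 'v set set list \<Rightarrow> bool"
  where shellingI:
    "shelling C Fs"
    if "pure_complex d C"
      and "distinct Fs" and "set Fs = facets C"
      and "d = 0 \<or>
        (\<exists>Gs. shelling (boundary_complex (Fs ! 0)) Gs) \<and>
        (\<forall>j\<in>{1..<length Fs}.
          Fs ! j \<inter> \<Union>(set (take j Fs)) \<noteq> {{}} \<and>
          (\<exists>Gs. shelling (boundary_complex (Fs ! j)) Gs \<and>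
            (\<exists>r\<in>{1..length Gs}. Fs ! j \<inter> \<Union>(set (take j Fs)) = \<Union>(set (take r Gs)))))"

definition shellable :: "'v set set set \<Rightarrow> bool"
  where "shellable C \<longleftrightarrow> (\<exists>d. pure_complex d C) \<and> (\<exists>Fs. shelling C Fs)"


section \<open>Stable relative complexes and stable shellings\<close>

text \<open>The atoms of \<open>X\<close>, ordered by \<open>le\<close>, where \<open>z\<close> is the least element.\<close>

definition atoms :: "('a \<Rightarrow> 'a \<Rightarrow> bool) \<Rightarrow> 'a set \<Rightarrow> 'a set"
  where "atoms le X =
    {a \<in> X. \<exists>z\<in>X. (\<forall>x\<in>X. le z x) \<and> a \<noteq> z \<and> (\<forall>b\<in>X. le b a \<longrightarrow> b = z \<or> b = a)}"

definition face_interval :: "'v set set \<Rightarrow> 'v set set \<Rightarrow> 'v set set set"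
  where "face_interval F P = {G \<in> faces P. F \<subseteq> G}"

text \<open>
  A relative complex \<open>C \<setminus> D\<close> is represented by the pair \<open>(C, D)\<close>, since isomorphisms
  depend on both complexes. The dual of a poset of faces is obtained by reversing the inclusion.
\<close>

type_synonym 'v relative_complex = "'v set set set \<times> 'v set set set"

definition reciprocal_domain1 :: "'v set set \<Rightarrow> 'v set set \<Rightarrow> 'v relative_complex"
  where "reciprocal_domain1 F P =
    (faces P, complex_of (atoms (\<lambda>G H. H \<subseteq> G) (face_interval F P)))"

definition reciprocal_domain2 :: "'v set set \<Rightarrow> 'v set set \<Rightarrow> 'v relative_complex"
  where "reciprocal_domain2 F P =
    (faces P,
     complex_of (atoms (\<lambda>G H. H \<subseteq> G) (faces P) - atoms (\<lambda>G H. H \<subseteq> G) (face_interval F P)))"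

definition rel_isomorphic :: "'v relative_complex \<Rightarrow> 'w relative_complex \<Rightarrow> bool"
  where "rel_isomorphic R R' \<longleftrightarrow>
    (\<exists>f. bij_betw f (fst R) (fst R') \<and>
      (\<forall>P\<in>fst R. \<forall>Q\<in>fst R. P \<subseteq> Q \<longleftrightarrow> f P \<subseteq> f Q) \<and>
      f ` snd R = snd R')"

text \<open>Every abstract polytope has finitely many vertices, so labels in \<open>nat\<close> suffice for \<open>P\<close>.\<close>

definition stable :: "'v relative_complex \<Rightarrow> bool"
  where "stable R \<longleftrightarrow>
    (\<exists>(P :: nat set set) F. abs_polytope P \<and> F \<in> faces P \<and>
      (rel_isomorphic R (reciprocal_domain1 F P) \<or> rel_isomorphic R (reciprocal_domain2 F P)))"

definition shelling_step :: "'v set set list \<Rightarrow> nat \<Rightarrow> 'v relative_complex"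
  where "shelling_step Fs i = (faces (Fs ! i), faces (Fs ! i) \<inter> complex_of (set (take i Fs)))"

definition stable_shelling :: "'v set set set \<Rightarrow> 'v set set list \<Rightarrow> bool"
  where "stable_shelling C Fs \<longleftrightarrow>
    shelling C Fs \<and> (\<forall>i<length Fs. stable (shelling_step Fs i))"

end

theory Submission
  imports Defs
begin

text \<open>
  An abstract simplex is a power set \<open>Pow V\<close>, and every union of its facets consists of the
  sets \<open>Pow G\<close> with \<open>G \<subseteq> V - {v}\<close> for some \<open>v\<close> in a fixed \<open>W \<subseteq> V\<close>. These facets are exactly the
  ones containing the face \<open>V - W\<close>, so any such union is the subcomplex removed in the first
  reciprocal domain of that face. By the definition of a shelling, the part of each facet covered
  by the earlier ones is such a union, with \<open>W = {}\<close> for the first facet and \<open>W = V\<close> for later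
  facets in dimension 0.
\<close>

section \<open>Faces and vertices of simplices in real vector spaces\<close>

text \<open>
  The type \<open>point\<close> is not in the class \<open>euclidean_space\<close>, so the library's description of the faces
  of a simplex does not apply to it; the following lemmas need neither compactness nor dimension.
\<close>

lemma affine_hull_disjoint_if_affine_independent:
  fixes B :: "'a::real_vector set"
  assumes "finite B" "\<not> affine_dependent B" "S \<subseteq> B"
  shows "affine hull S \<inter> affine hull (B - S) = {}"
proof (rule ccontr)
  assume "affine hull S \<inter> affine hull (B - S) \<noteq> {}"
  then obtain x where "x \<in> affine hull S" "x \<in> affine hull (B - S)"
    by blast
  moreover have fin: "finite S" "finite (B - S)"
    using assms finite_subset by auto
  ultimately obtain u w
    where u: "sum u S = 1" "(\<Sum>b\<in>S. u b *\<^sub>R b) = x"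
      and w: "sum w (B - S) = 1" "(\<Sum>b\<in>B - S. w b *\<^sub>R b) = x"
    by (auto simp: affine_hull_finite)
  \<comment> \<open>A common point \<open>x\<close> has coefficients \<open>u\<close> over
    \<open>S\<close> and \<open>w\<close> over \<open>B - S\<close>. Joining \<open>u\<close> and
    \<open>- w\<close> gives coefficients of sum \<open>1 - 1\<close> and combination
    \<open>x - x\<close>, a nontrivial affine dependence of \<open>B\<close>.\<close>
  define c where "c b = (if b \<in> S then u b else - w b)" for b
  have split: "sum h B = sum h S + sum h (B - S)" for h :: "'a \<Rightarrow> 'b::comm_monoid_add"
    using assms by (metis add.commute sum.subset_diff)
  have "sum c S = 1" "(\<Sum>b\<in>S. c b *\<^sub>R b) = x"
    using u by (auto simp: c_def cong: sum.cong)
  moreover have "sum c (B - S) = - 1" "(\<Sum>b\<in>B - S. c b *\<^sub>R b) = - x"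
    unfolding w(1)[symmetric] w(2)[symmetric] sum_negf[symmetric]
    by (auto simp: c_def intro: sum.cong)
  moreover have "\<exists>b\<in>B. c b \<noteq> 0"
    using \<open>sum c S = 1\<close> assms(3) by (metis sum.neutral subsetD zero_neq_one)
  ultimately have "affine_dependent B"
    unfolding affine_dependent_explicit_finite[OF assms(1)]
    by (intro exI[of _ c]) (simp add: split[of c] split[of "\<lambda>b. c b *\<^sub>R b"])
  with assms(2) show False ..
qed

lemma face_of_convex_hull_eq:
  fixes B :: "'a::real_vector set"
  assumes F: "F face_of (convex hull B)"
  shows "F = convex hull (F \<inter> B)"
proof
  \<comment> \<open>\<open>K\<close> is the hull of \<open>B\<close> with the part of
    \<open>F\<close> outside \<open>convex hull (F \<inter> B)\<close> removed. It contains
    \<open>B\<close>, and it is convex because a segment with an interior point in the face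
    \<open>F\<close> has both ends in \<open>F\<close>; so it is the whole hull.\<close>
  define K where "K = {x \<in> convex hull B. x \<in> F \<longrightarrow> x \<in> convex hull (F \<inter> B)}"
  have "convex K"
    unfolding convex_contains_open_segment
  proof (intro ballI subsetI)
    fix x y z assume xy: "x \<in> K" "y \<in> K" and z: "z \<in> open_segment x y"
    have "z \<in> convex hull B"
      using xy z convex_convex_hull[of B] unfolding K_def convex_contains_open_segment by blast
    moreover have "z \<in> convex hull (F \<inter> B)" if "z \<in> F"
    proof -
      have "x \<in> F" "y \<in> F"
        using face_ofD[OF F z _ _ that] xy by (auto simp: K_def)
      then show ?thesis
        using xy z convex_convex_hull[of "F \<inter> B"]
        unfolding K_def convex_contains_open_segment by blast
    qed
    ultimately show "z \<in> K"
      by (simp add: K_def)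
  qed
  moreover have "B \<subseteq> K"
    by (auto simp: K_def hull_inc)
  ultimately have "convex hull B \<subseteq> K"
    by (simp add: hull_minimal)
  then show "F \<subseteq> convex hull (F \<inter> B)"
    using face_of_imp_subset[OF F] by (auto simp: K_def)
  show "convex hull (F \<inter> B) \<subseteq> F"
    using F by (simp add: face_of_imp_convex hull_minimal)
qed

text \<open>Conversely to the previous lemma, every \<open>S \<subseteq> B\<close> spans a face,
  since the affine hull of \<open>S\<close> misses the convex hull of the remaining
  vertices.\<close>

lemma faces_of_simplex:
  fixes B :: "'a::real_vector set"
  assumes "finite B" "\<not> affine_dependent B"
  shows "{F. F face_of (convex hull B)} = (hull) convex ` Pow B"
proof (intro equalityI subsetI)
  fix F assume "F \<in> {F. F face_of (convex hull B)}"
  then show "F \<in> (hull) convex ` Pow B"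
    using face_of_convex_hull_eq by blast
next
  fix F assume "F \<in> (hull) convex ` Pow B"
  then obtain S where S: "S \<subseteq> B" "F = convex hull S"
    by blast
  then have "affine hull S \<inter> convex hull (B - S) = {}"
    using affine_hull_disjoint_if_affine_independent[OF assms] convex_hull_subset_affine_hull
    by blast
  then show "F \<in> {F. F face_of (convex hull B)}"
    using face_of_convex_hulls S assms by blast
qed

lemma verts_simplex:
  assumes "finite B" "\<not> affine_dependent B"
  shows "verts (convex hull B) = B"
proof -
  have "b extreme_point_of (convex hull B)" if "b \<in> B" for b
  proof -
    have "convex hull {b} \<in> (hull) convex ` Pow B"
      using that by blast
    then show ?thesis
      unfolding faces_of_simplex[OF assms, symmetric] by (simp add: face_of_singleton)
  qed
  then show ?thesis
    using extreme_point_of_convex_hull unfolding verts_def by blast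
qed

lemma verts_faces_of_simplex:
  assumes "finite B" "\<not> affine_dependent B"
  shows "verts ` {F. F face_of (convex hull B)} = Pow B"
proof -
  have "verts (convex hull S) = S" if "S \<in> Pow B" for S
    using that assms verts_simplex affine_independent_subset finite_subset by blast
  then show ?thesis
    unfolding faces_of_simplex[OF assms] image_image by simp
qed

section \<open>Abstract simplices as power sets\<close>

text \<open>The faces of a simplex have all subsets of \<open>B\<close> as vertex sets, so a
  labelling of the vertices turns them into a full power set.\<close>

lemma realizes_simplex_iff:
  fixes P :: "'v set set"
  assumes "finite B" "\<not> affine_dependent B"
  shows "realizes (convex hull B) P \<longleftrightarrow> (\<exists>\<phi>. inj_on \<phi> B \<and> P = Pow (\<phi> ` B))"
proof -
  have "(\<lambda>F. \<phi> ` verts F) ` {F. F face_of (convex hull B)} = Pow (\<phi> ` B)" for \<phi> :: "point \<Rightarrow> 'v"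
    using verts_faces_of_simplex[OF assms] by (metis image_Pow_surj image_image)
  moreover have "polytope (convex hull B)"
    using assms polytope_def by blast
  ultimately show ?thesis
    unfolding realizes_def verts_simplex[OF assms] by simp
qed

lemma abs_simplexE:
  assumes "abs_simplex P"
  obtains V where "finite V" "P = Pow V"
proof -
  obtain B where B: "finite B" "\<not> affine_dependent B" "realizes (convex hull B) P"
    using assms unfolding abs_simplex_def by blast
  then obtain \<phi> where "P = Pow (\<phi> ` B)"
    unfolding realizes_simplex_iff[OF B(1,2)] by (elim exE conjE)
  with B(1) show ?thesis
    by (intro that[of "\<phi> ` B"]) simp_all
qed

text \<open>The standard basis vectors; those with index in \<open>V\<close> serve as the vertices
  of a simplex realizing \<open>Pow V\<close>.\<close>

definition unit_point :: "nat \<Rightarrow> point"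
  where "unit_point k = Poly_Mapping.single k 1"

lemma lookup_unit_point: "Poly_Mapping.lookup (unit_point k) i = (if i = k then 1 else 0)"
  by (auto simp: unit_point_def lookup_single when_def)

lemma inj_unit_point: "inj unit_point"
proof (rule injI)
  fix j k assume "unit_point j = unit_point k"
  then have "Poly_Mapping.lookup (unit_point j) j = Poly_Mapping.lookup (unit_point k) j"
    by simp
  then show "j = k"
    by (simp add: lookup_unit_point split: if_splits)
qed

lemma affine_independent_unit_points:
  assumes "finite V"
  shows "\<not> affine_dependent (unit_point ` V)"
proof
  have inj: "inj_on unit_point V"
    using inj_unit_point by (rule inj_on_subset) simp
  assume "affine_dependent (unit_point ` V)"
  then obtain u k where k: "k \<in> V" "u (unit_point k) \<noteq> 0"
    and u: "(\<Sum>b\<in>unit_point ` V. u b *\<^sub>R b) = 0"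
    unfolding affine_dependent_explicit_finite[OF finite_imageI[OF assms]] by auto
  have lookup_scaleR: "Poly_Mapping.lookup (r *\<^sub>R x) i = r * Poly_Mapping.lookup x i"
    for r i and x :: point
    by (simp add: scaleR_poly_mapping_def Abs_poly_mapping_inverse)
  \<comment> \<open>Coordinate \<open>k\<close> of the vanishing combination is the coefficient of
    \<open>unit_point k\<close>.\<close>
  have "0 = Poly_Mapping.lookup (\<Sum>b\<in>unit_point ` V. u b *\<^sub>R b) k"
    by (simp only: u lookup_zero)
  also have "\<dots> = (\<Sum>i\<in>V. u (unit_point i) * (if k = i then 1 else 0))"
    by (simp only: lookup_sum lookup_scaleR sum.reindex[OF inj] o_def lookup_unit_point)
  also have "\<dots> = u (unit_point k)"
    using k assms by (simp add: if_distrib cong: if_cong)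
  finally show False
    using k by simp
qed

text \<open>Supplies the polytope with labels in \<open>nat\<close> that \<open>stable\<close> asks
  for.\<close>

lemma abs_polytope_Pow:
  fixes V :: "nat set"
  assumes "finite V"
  shows "abs_polytope (Pow V)"
proof -
  have "inj_on (inv unit_point) (unit_point ` V)"
    by (rule inj_on_inv_into) blast
  moreover have "inv unit_point ` unit_point ` V = V"
    using inj_unit_point by (rule image_inv_f_f)
  ultimately have "realizes (convex hull (unit_point ` V)) (Pow V)"
    unfolding realizes_simplex_iff[OF finite_imageI[OF assms] affine_independent_unit_points[OF assms]]
    by (intro exI[of _ "inv unit_point"]) simp
  then show ?thesis
    unfolding abs_polytope_def ..
qed

lemma abs_simplex_dim_0E:
  assumes "abs_simplex P" "poly_dim P = 0"
  obtains v where "P = Pow {v}"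
proof -
  obtain Q B where "realizes Q P" "finite B" "\<not> affine_dependent B" "Q = convex hull B"
    using assms(1) abs_simplex_def by blast
  then have "\<exists>Q. realizes Q P \<and> has_affine_dim Q (int (card B) - 1)"
    unfolding has_affine_dim_def using affine_hull_convex_hull by (metis diff_add_cancel)
  \<comment> \<open>\<open>poly_dim\<close> is a choice, so only the existence of some dimension
    lets \<open>someI\<close> apply. The realization \<open>Q'\<close> obtained for the chosen
    dimension 0 may differ from \<open>Q\<close>, but its affine hull is a single point, so it is a
    simplex as well.\<close>
  then have "\<exists>Q. realizes Q P \<and> has_affine_dim Q (poly_dim P)"
    unfolding poly_dim_def by (rule someI)
  then obtain Q' B' where Q': "realizes Q' P" "affine hull B' = affine hull Q'" "int (card B') = 1"
    using assms(2) by (auto simp: has_affine_dim_def)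
  then obtain b where "B' = {b}"
    by (metis card_1_singletonE of_nat_eq_1_iff)
  then have "affine hull Q' = {b}"
    using Q'(2) hull_same[of affine, OF affine_sing[of b]] by simp
  moreover have "Q' \<subseteq> affine hull Q'"
    by (rule hull_subset)
  moreover have "Q' \<noteq> {}"
    using \<open>affine hull Q' = {b}\<close> by auto
  ultimately have "Q' = {b}"
    by (simp add: subset_singleton_iff)
  then have "realizes (convex hull {b}) P"
    using Q' by simp
  then obtain \<phi> where "P = Pow (\<phi> ` {b})"
    using realizes_simplex_iff[of "{b}" P] by auto
  then show ?thesis
    using that by simp
qed

section \<open>Face lattices and reciprocal domains of power sets\<close>

lemma Pow_subset_Pow_iff: "Pow A \<subseteq> Pow B \<longleftrightarrow> A \<subseteq> B"
  by (metis Pow_mono Pow_top PowD subsetD)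

lemma inj_on_Pow: "inj_on Pow X"
  by (rule inj_on_inverseI[of _ Union]) simp

lemma faces_Pow: "faces (Pow V) = Pow ` Pow V"
proof -
  have "{H \<in> Pow V. H \<subseteq> G} = Pow G" if "G \<in> Pow V" for G
    using that by auto
  then have "(\<lambda>G. {H \<in> Pow V. H \<subseteq> G}) ` Pow V = Pow ` Pow V"
    by (intro image_cong) simp_all
  then show ?thesis
    unfolding faces_def by (simp only: Setcompr_eq_image)
qed

lemma face_interval_Pow: "face_interval (Pow G) (Pow V) = Pow ` {H. G \<subseteq> H \<and> H \<subseteq> V}"
proof -
  have "face_interval (Pow G) (Pow V) = Pow ` {H \<in> Pow V. Pow G \<subseteq> Pow H}"
    unfolding face_interval_def faces_Pow by (simp only: Compr_image_eq)
  then show ?thesis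
    by (simp add: Pow_subset_Pow_iff conj_commute)
qed

lemma atoms_dual_face_interval_Pow:
  assumes "G \<subseteq> V"
  shows "atoms (\<lambda>G H. H \<subseteq> G) (face_interval (Pow G) (Pow V)) = (\<lambda>v. Pow (V - {v})) ` (V - G)"
    (is "?A = ?B")
proof (intro equalityI subsetI)
  fix P assume "P \<in> ?A"
  then obtain Z where P: "P \<in> face_interval (Pow G) (Pow V)"
    and Z: "\<forall>x\<in>face_interval (Pow G) (Pow V). x \<subseteq> Z" "Z \<in> face_interval (Pow G) (Pow V)" "P \<noteq> Z"
    and max: "\<forall>b\<in>face_interval (Pow G) (Pow V). P \<subseteq> b \<longrightarrow> b = Z \<or> b = P"
    unfolding atoms_def by auto
  \<comment> \<open>The order is reversed inclusion, so the least element is the whole polytope and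
    the atoms are the maximal proper faces in the interval.\<close>
  have ZV: "Z = Pow V"
  proof
    show "Z \<subseteq> Pow V"
      using Z(2) unfolding face_interval_Pow by auto
    have "Pow V \<in> face_interval (Pow G) (Pow V)"
      using assms unfolding face_interval_Pow by auto
    then show "Pow V \<subseteq> Z"
      using Z(1) by blast
  qed
  obtain H where H: "P = Pow H" "G \<subseteq> H" "H \<subseteq> V"
    using P unfolding face_interval_Pow by blast
  then obtain v where v: "v \<in> V - H"
    using Z(3) ZV by blast
  then have "Pow (V - {v}) \<in> face_interval (Pow G) (Pow V)" "P \<subseteq> Pow (V - {v})"
    using H unfolding face_interval_Pow by auto
  then have "Pow (V - {v}) = Pow V \<or> Pow (V - {v}) = P"
    using max ZV by blast
  moreover have "Pow (V - {v}) \<noteq> Pow V"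
    using v by auto
  ultimately have "Pow (V - {v}) = P"
    by simp
  then show "P \<in> ?B"
    using v H by blast
next
  fix P assume "P \<in> ?B"
  then obtain v where v: "v \<in> V" "v \<notin> G" "P = Pow (V - {v})"
    by blast
  have "b = Pow V \<or> b = P" if b: "b \<in> face_interval (Pow G) (Pow V)" "P \<subseteq> b" for b
  proof -
    obtain H where "b = Pow H" "H \<subseteq> V"
      using b unfolding face_interval_Pow by blast
    \<comment> \<open>Between \<open>V - {v}\<close> and \<open>V\<close> there are only these two
      sets, told apart by whether \<open>v \<in> H\<close>.\<close>
    moreover from this have "V - {v} \<subseteq> H"
      using b v by auto
    ultimately show ?thesis
      using v by (cases "v \<in> H") auto
  qed
  moreover have "P \<noteq> Pow V"
    using v by auto
  moreover have "Pow V \<in> face_interval (Pow G) (Pow V)" "P \<in> face_interval (Pow G) (Pow V)"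
    using v assms unfolding face_interval_Pow by auto
  moreover have "\<forall>x\<in>face_interval (Pow G) (Pow V). x \<subseteq> Pow V"
    unfolding face_interval_Pow by auto
  ultimately show "P \<in> ?A"
    unfolding atoms_def by blast
qed

lemma reciprocal_domain1_Pow:
  assumes "W \<subseteq> V"
  shows "reciprocal_domain1 (Pow (V - W)) (Pow V) = (Pow ` Pow V, Pow ` (\<Union>v\<in>W. Pow (V - {v})))"
proof -
  have "V - (V - W) = W"
    using assms by blast
  then show ?thesis
    unfolding reciprocal_domain1_def faces_Pow complex_of_def atoms_dual_face_interval_Pow[OF Diff_subset]
    by (simp add: faces_Pow image_UN)
qed

text \<open>The witness is the first reciprocal domain of the face \<open>V - W\<close>, after an
  injective relabelling of the vertices by natural numbers.\<close>

lemma stable_simplex_minus_facets: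
  fixes V :: "'v set"
  assumes "finite V" "W \<subseteq> V"
  shows "stable (faces (Pow V), Pow ` (\<Union>v\<in>W. Pow (V - {v})))"
proof -
  obtain f :: "'v \<Rightarrow> nat" where f: "inj_on f V"
    using assms(1) finite_imp_inj_to_nat_seg by blast
  \<comment> \<open>Members of a complex are families of vertex sets, so the relabelling
    \<open>f\<close> acts two levels down.\<close>
  define g where "g = (`) ((`) f)"
  have g_Pow: "g (Pow G) = Pow (f ` G)" for G
    unfolding g_def by (simp add: image_Pow_surj)
  have f_Diff: "f ` (V - X) = f ` V - f ` X" if "X \<subseteq> V" for X
    using f that by (simp add: inj_on_image_set_diff)
  have g_mono: "P \<subseteq> Q \<longleftrightarrow> g P \<subseteq> g Q" if PQ: "P \<in> Pow ` Pow V" "Q \<in> Pow ` Pow V" for P Q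
  proof -
    obtain G where "P = Pow G" "G \<in> Pow V"
      by (rule imageE[OF PQ(1)])
    moreover obtain H where "Q = Pow H" "H \<in> Pow V"
      by (rule imageE[OF PQ(2)])
    ultimately show ?thesis
      using f by (simp add: g_Pow Pow_subset_Pow_iff inj_on_image_subset_iff)
  qed
  have "g ` Pow ` Pow V = Pow ` Pow (f ` V)"
    unfolding image_Pow_surj[OF refl, of f V, symmetric] by (simp only: image_image g_Pow)
  moreover have "inj_on g (Pow ` Pow V)"
  proof (rule inj_onI)
    fix P Q assume "P \<in> Pow ` Pow V" "Q \<in> Pow ` Pow V" "g P = g Q"
    \<comment> \<open>An order embedding is injective by antisymmetry.\<close>
    then show "P = Q"
      using g_mono[of P Q] g_mono[of Q P] by simp
  qed
  moreover have "g ` Pow ` (\<Union>v\<in>W. Pow (V - {v})) = Pow ` (\<Union>w\<in>f ` W. Pow (f ` V - {w}))"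
  proof -
    have "g ` Pow ` (\<Union>v\<in>W. Pow (V - {v})) = Pow ` (\<Union>v\<in>W. (`) f ` Pow (V - {v}))"
      by (simp only: image_UN image_image g_Pow)
    also have "(\<Union>v\<in>W. (`) f ` Pow (V - {v})) = (\<Union>v\<in>W. Pow (f ` V - {f v}))"
    proof (rule SUP_cong[OF refl])
      fix v assume "v \<in> W"
      then have "f ` (V - {v}) = f ` V - {f v}"
        using f_Diff[of "{v}"] assms(2) by auto
      then show "(`) f ` Pow (V - {v}) = Pow (f ` V - {f v})"
        by (rule image_Pow_surj)
    qed
    finally show ?thesis
      by (simp only: image_image)
  qed
  ultimately have "rel_isomorphic (faces (Pow V), Pow ` (\<Union>v\<in>W. Pow (V - {v})))
      (reciprocal_domain1 (Pow (f ` V - f ` W)) (Pow (f ` V)))"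
    unfolding rel_isomorphic_def reciprocal_domain1_Pow[OF image_mono[OF assms(2)]] faces_Pow
    unfolding fst_conv snd_conv bij_betw_def
    by (intro exI[of _ g] conjI ballI) (assumption | rule g_mono)+
  moreover have "Pow (f ` V - f ` W) \<in> faces (Pow (f ` V))"
    unfolding faces_Pow by (rule imageI) blast
  ultimately show ?thesis
    unfolding stable_def using abs_polytope_Pow[OF finite_imageI[OF assms(1)]] by blast
qed

section \<open>Shelling steps of simplicial complexes\<close>

text \<open>A proper face misses some vertex \<open>v\<close>, hence lies in the face opposite
  \<open>v\<close>; maximality makes the two equal.\<close>

lemma facets_boundary_Pow: "facets (boundary_complex (Pow V)) \<subseteq> (\<lambda>v. Pow (V - {v})) ` V"
proof
  fix P assume P: "P \<in> facets (boundary_complex (Pow V))"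
  then have "P \<in> Pow ` Pow V" "P \<noteq> Pow V"
    by (simp_all add: facets_def boundary_complex_def faces_Pow)
  then obtain G where G: "P = Pow G" "G \<subseteq> V" "G \<noteq> V"
    by (metis PowD imageE)
  then obtain v where v: "v \<in> V" "v \<notin> G"
    by blast
  then have "Pow (V - {v}) \<noteq> Pow V" "P \<subseteq> Pow (V - {v})"
    using G by auto
  moreover have "Pow (V - {v}) \<in> Pow ` Pow V"
    by (rule imageI) simp
  ultimately have "Pow (V - {v}) = P"
    using P by (simp add: facets_def boundary_complex_def faces_Pow)
  then show "P \<in> (\<lambda>v. Pow (V - {v})) ` V"
    using v by blast
qed

text \<open>Translates between \<open>shelling_step\<close>, which intersects complexes, and
  \<open>shelling\<close>, which intersects unions of polytopes: \<open>Pow\<close> maps a vertex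
  set to the face it spans, and it is injective.\<close>

lemma faces_Pow_Int_complex_of:
  assumes "\<And>P. P \<in> \<P> \<Longrightarrow> \<exists>U. P = Pow U"
  shows "faces (Pow V) \<inter> complex_of \<P> = Pow ` (Pow V \<inter> \<Union>\<P>)"
proof -
  have faces: "faces P = Pow ` P" if "P \<in> \<P>" for P
    using assms[OF that] faces_Pow by (elim exE) simp
  have "complex_of \<P> = Pow ` \<Union>\<P>"
    unfolding complex_of_def image_Union using faces by (rule SUP_cong[OF refl])
  then show ?thesis
    unfolding faces_Pow by (simp only: image_Int[OF inj_on_Pow])
qed

theorem proposition3p2:
  fixes C :: "'v set set set" and Fs :: "'v set set list"
  assumes "simplicial_polytopal_complex C" and "shellable C"
    and "shelling C Fs"
  shows "stable_shelling C Fs"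
  unfolding stable_shelling_def
proof (intro conjI allI impI)
  fix i assume i: "i < length Fs"
  obtain d where pure: "pure_complex d C" and dist: "distinct Fs" and Fs: "set Fs = facets C"
    and shell: "d = 0 \<or>
      (\<forall>j\<in>{1..<length Fs}. \<exists>Gs. shelling (boundary_complex (Fs ! j)) Gs \<and>
        (\<exists>r\<in>{1..length Gs}. Fs ! j \<inter> \<Union>(set (take j Fs)) = \<Union>(set (take r Gs))))"
    using assms(3) by (cases rule: shelling.cases) auto
  have simplex: "abs_simplex F" if "F \<in> set Fs" for F
    using that assms(1) Fs by (simp add: simplicial_polytopal_complex_def)
  obtain V where V: "finite V" "Fs ! i = Pow V"
    using abs_simplexE[OF simplex[OF nth_mem[OF i]]] .
  have step: "shelling_step Fs i = (faces (Pow V), Pow ` (Pow V \<inter> \<Union>(set (take i Fs))))"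
    unfolding shelling_step_def V(2)
  proof (subst faces_Pow_Int_complex_of)
    fix P assume "P \<in> set (take i Fs)"
    then show "\<exists>U. P = Pow U"
      using abs_simplexE[OF simplex] in_set_takeD by metis
  qed (rule refl)
  have "\<exists>W\<subseteq>V. Pow V \<inter> \<Union>(set (take i Fs)) = (\<Union>v\<in>W. Pow (V - {v}))"
  proof -
    consider "i = 0" | "i > 0" "d = 0" | "i > 0" "d \<noteq> 0"
      by auto
    then show ?thesis
    proof cases
      \<comment> \<open>Nothing precedes the first facet, so the union is \<open>{}\<close> and
        lacks even the empty face.\<close>
      case 1
      then show ?thesis
        by (intro exI[of _ "{}"]) simp
    next
      case 2
      have point: "\<exists>v. F = Pow {v}" if "F \<in> set Fs" for F
      proof -
        have "poly_dim F = 0"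
          using that pure Fs 2 by (simp add: pure_complex_def)
        then show ?thesis
          using abs_simplex_dim_0E[OF simplex[OF that]] by blast
      qed
      obtain v where v: "V = {v}"
        using point[OF nth_mem[OF i]] V by (metis Union_Pow_eq)
      \<comment> \<open>Distinct facets are distinct points, which share only the empty
        face.\<close>
      have "F \<inter> Pow V = {{}}" if F: "F \<in> set (take i Fs)" for F
      proof -
        obtain w where w: "F = Pow {w}"
          using point[OF in_set_takeD[OF F]] by blast
        have "Fs ! i \<notin> set (take i Fs)"
          using dist i by (auto simp: in_set_conv_nth nth_eq_iff_index_eq)
        then have "w \<noteq> v"
          using F w v V by auto
        then show ?thesis
          using w v by auto
      qed
      \<comment> \<open>As \<open>i > 0\<close>, the union contains the empty face, so the
        intersection is \<open>{{}}\<close> rather than \<open>{}\<close>. This is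
        \<open>Pow ({v} - {v})\<close>, whence \<open>W = {v}\<close>.\<close>
      moreover have "set (take i Fs) \<noteq> {}"
        using 2 i by auto
      ultimately have "Pow V \<inter> \<Union>(set (take i Fs)) = {{}}"
        by (simp add: Int_Union inf_commute)
      then show ?thesis
        using v by (intro exI[of _ "{v}"]) auto
    next
      case 3
      then have "i \<in> {1..<length Fs}"
        using i by simp
      then obtain Gs r where Gs: "shelling (boundary_complex (Pow V)) Gs"
        and eq: "Pow V \<inter> \<Union>(set (take i Fs)) = \<Union>(set (take r Gs))"
        using shell 3(2) V(2) by metis
      have "set Gs = facets (boundary_complex (Pow V))"
        using Gs by cases
      then have "set (take r Gs) \<subseteq> (\<lambda>v. Pow (V - {v})) ` V"
        using facets_boundary_Pow set_take_subset by fastforce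
      \<comment> \<open>\<open>W\<close> collects the vertices opposite to the first
        \<open>r\<close> facets in the shelling of the boundary.\<close>
      then obtain W where "W \<subseteq> V" "set (take r Gs) = (\<lambda>v. Pow (V - {v})) ` W"
        by (rule subset_imageE)
      then show ?thesis
        unfolding eq by (intro exI[of _ W]) simp
    qed
  qed
  then show "stable (shelling_step Fs i)"
    unfolding step using stable_simplex_minus_facets[OF V(1)] by metis
qed (fact assms(3))

end
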